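(* Let $\Theta=(E,sim,ser,inl)$ be a g-comtrace alphabet and let $s\in\mathbb{S}^*$ be a step sequence over $\Theta$. Then $ext\big(G^{\{s\}}\big)=\{\lhd_u \mid u\in[s]\}$.
   Context: Relations: for a binary relation $R$ on a set $X$, $R^{-1}$ is its inverse, $R^0=\mathrm{id}_X$, $R^*=\bigcup_{i\ge 0}R^i$, $R\circ S=\{(x,y):\exists z.\,(x,z)\in R\wedge (z,y)\in S\}$, $R^{\mathrm{sym}}=R\cup R^{-1}$, $R^{\Cap}=R\cap R^{-1}$, $R^{C}=(X\times X)\setminus R$. G-comtraces: a g-comtrace alphabet is $\Theta=(E,sim,ser,inl)$ with $E$ finite, $sim,inl\subseteq E\times E$ irreflexive and symmetric, $ser\subseteq sim$, $sim\cap inl=\emptyset$. Steps: $\mathbb{S}$ is the set of nonempty $A\subseteq E$ with $(a,b)\in sim$ for all distinct $a,b\in A$. Step sequences are elements of the free monoid $\mathbb{S}^*$. The g-comtrace congruence $\equiv$ is the reflexive symmetric transitive closure of the relation containing all pairs $(wAz,wBCz)$ with $w,z\in\mathbb{S}^*$, $A,B,C\in\mathbb{S}$, $A=B\cup C$, $B\times C\subseteq ser$, and all pairs $(wABz,wBAz)$ with $A,B\in\mathbb{S}$, $A\times B\subseteq inl$. $[s]$ is the class of $s$. Event occurrences: for $s=A_1\dots A_k$ and $e\in E$, let $|A_1\dots A_i|_e$ be the number of $j\le i$ with $e\in A_j$; set $\overline{A_i}=\{e^{(|A_1\dots A_{i-1}|_e+1)}: e\in A_i\}$, $\Sigma_s=\bigcup_i\overline{A_i}$,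 label $l(e^{(j)})=e$, and $pos_s(\alpha)=i$ iff $\alpha\in\overline{A_i}$. If $s\equiv u$ then $\Sigma_s=\Sigma_u$. Put $\alpha\lhd_s\beta$ iff $pos_s(\alpha)<pos_s(\beta)$, and $\alpha\lhd_s^\frown\beta$ iff $\alpha\ne\beta$ and $pos_s(\alpha)\le pos_s(\beta)$. Closures: for $(X,R_1,R_2)$, $(X,R_1,R_2)^\lozenge=(X,\prec_{R_1,R_2},\sqsubset_{R_1,R_2})$ where $\prec_{R_1,R_2}=(R_1\cup R_2)^*\circ R_1\circ(R_1\cup R_2)^*$ and $\sqsubset_{R_1,R_2}=(R_1\cup R_2)^*\setminus\mathrm{id}_X$. For $G=(X,R_1,R_2)$ and $R_3=R_1\cap R_2^*$, the commutative closure is $G^{\bowtie}=(X,(\prec_{R_3,R_2})^{\mathrm{sym}}\cup R_1,\sqsubset_{R_3,R_2})$. The structure $G^{\{s\}}$: on $\Sigma_s$ define $\alpha<\!\!>_s\beta$ iff $(l(\alpha),l(\beta))\in inl$; $\alpha\sqsubset_s\beta$ iff $\alpha\lhd_s^\frown\beta$ and $(l(\beta),l(\alpha))\notin ser\cup inl$; $\alpha\prec_s\beta$ iff $\alpha\lhd_s\beta$ and at least one of: (i) $(l(\alpha),l(\beta))\notin ser\cup inl$; (ii) $(\alpha,\beta)\in <\!\!>_s\cap\big((\sqsubset_s^* )^{\Cap}\circ(<\!\!>_s)^{C}\circ(\sqsubset_s^* )^{\Cap}\big)$; (iii) $(l(\alpha),l(\beta))\in ser$ and there exist $\delta,\gamma\in\Sigma_s$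 with $\delta\lhd_s\gamma$, $(l(\delta),l(\gamma))\notin ser$, $\alpha\sqsubset_s^*\delta\sqsubset_s^*\beta$ and $\alpha\sqsubset_s^*\gamma\sqsubset_s^*\beta$ (all closures on $\Sigma_s$). Then $G^{\{s\}}=(\Sigma_s,\prec_s\cup<\!\!>_s,\prec_s\cup\sqsubset_s)^{\bowtie}$. Extensions: a stratified order on $X$ is an irreflexive transitive relation $\lhd$ such that $a\simeq b\iff(a=b\vee(\neg a\lhd b\wedge\neg b\lhd a))$ is an equivalence; $\alpha\lhd^\frown\beta$ means $\alpha\ne\beta\wedge\neg(\beta\lhd\alpha)$. For a relational structure $G=(X,<\!\!>,\sqsubset)$, $ext(G)$ is the set of stratified orders $\lhd$ on $X$ such that $\alpha<\!\!>\beta\Rightarrow(\alpha\lhd\beta\vee\beta\lhd\alpha)$ and $\alpha\sqsubset\beta\Rightarrow\alpha\lhd^\frown\beta$. *)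

theory Defs
  imports Main
begin

section \<open>Relations on a carrier set\<close>

text \<open>
  Closures and complements are relative to a carrier \<open>X\<close>. For \<open>R \<subseteq> X \<times> X\<close>, the following is the union of
  all powers \<open>R\<^sup>i\<close>, \<open>i \<ge> 0\<close>, where \<open>R\<^sup>0\<close> is the identity on \<open>X\<close> (\<^term>\<open>rtrancl\<close> would contain the
  identity on the whole type).
\<close>

definition star_on :: "'x set \<Rightarrow> 'x rel \<Rightarrow> 'x rel" where
  "star_on X R = Id_on X \<union> R\<^sup>+"

definition sym_cl :: "'x rel \<Rightarrow> 'x rel" where
  "sym_cl R = R \<union> R\<inverse>"

definition sym_core :: "'x rel \<Rightarrow> 'x rel" where
  "sym_core R = R \<inter> R\<inverse>"

definition compl_on :: "'x set \<Rightarrow> 'x rel \<Rightarrow> 'x rel" where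
  "compl_on X R = (X \<times> X) - R"

section \<open>Generalised comtraces\<close>

record 'e gct_alphabet =
  events :: "'e set"
  sim :: "'e rel"
  ser :: "'e rel"
  inl :: "'e rel"

definition gcomtrace_alphabet :: "'e gct_alphabet \<Rightarrow> bool" where
  "gcomtrace_alphabet \<Theta> \<longleftrightarrow>
     finite (events \<Theta>) \<and>
     sim \<Theta> \<subseteq> events \<Theta> \<times> events \<Theta> \<and> irrefl (sim \<Theta>) \<and> sym (sim \<Theta>) \<and>
     inl \<Theta> \<subseteq> events \<Theta> \<times> events \<Theta> \<and> irrefl (inl \<Theta>) \<and> sym (inl \<Theta>) \<and>
     ser \<Theta> \<subseteq> sim \<Theta> \<and>
     sim \<Theta> \<inter> inl \<Theta> = {}"

definition steps :: "'e gct_alphabet \<Rightarrow> 'e set set" where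
  "steps \<Theta> = {A. A \<noteq> {} \<and> A \<subseteq> events \<Theta> \<and> (\<forall>a\<in>A. \<forall>b\<in>A. a \<noteq> b \<longrightarrow> (a, b) \<in> sim \<Theta>)}"

definition step_seqs :: "'e gct_alphabet \<Rightarrow> 'e set list set" where
  "step_seqs \<Theta> = lists (steps \<Theta>)"

definition gct_rewrite :: "'e gct_alphabet \<Rightarrow> 'e set list rel" where
  "gct_rewrite \<Theta> =
     {(w @ [A] @ z, w @ [B, C] @ z) | w A B C z.
        w \<in> step_seqs \<Theta> \<and> z \<in> step_seqs \<Theta> \<and> A \<in> steps \<Theta> \<and> B \<in> steps \<Theta> \<and> C \<in> steps \<Theta> \<and>
        A = B \<union> C \<and> B \<times> C \<subseteq> ser \<Theta>} \<union>
     {(w @ [A, B] @ z, w @ [B, A] @ z) | w A B z.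
        w \<in> step_seqs \<Theta> \<and> z \<in> step_seqs \<Theta> \<and> A \<in> steps \<Theta> \<and> B \<in> steps \<Theta> \<and>
        A \<times> B \<subseteq> inl \<Theta>}"

definition gct_cong :: "'e gct_alphabet \<Rightarrow> 'e set list rel" where
  "gct_cong \<Theta> = star_on (step_seqs \<Theta>) (sym_cl (gct_rewrite \<Theta>))"

definition gct_class :: "'e gct_alphabet \<Rightarrow> 'e set list \<Rightarrow> 'e set list set" where
  "gct_class \<Theta> s = gct_cong \<Theta> `` {s}"

section \<open>Event occurrences\<close>

text \<open>
  The occurrence \<open>e\<^bsup>(j)\<^esup>\<close> is the pair \<open>(e, j)\<close> with \<open>j \<ge> 1\<close>, and its label is its first component. Steps of a
  sequence are numbered from 0, as usual for lists; positions are only ever compared with one another.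
\<close>

type_synonym 'e occ = "'e \<times> nat"

definition occ_count :: "'e set list \<Rightarrow> 'e \<Rightarrow> nat" where
  "occ_count s e = card {j. j < length s \<and> e \<in> s ! j}"

definition occ_step :: "'e set list \<Rightarrow> nat \<Rightarrow> 'e occ set" where
  "occ_step s i = {(e, occ_count (take i s) e + 1) | e. e \<in> s ! i}"

definition occs :: "'e set list \<Rightarrow> 'e occ set" where
  "occs s = (\<Union>i<length s. occ_step s i)"

abbreviation lab :: "'e occ \<Rightarrow> 'e" where
  "lab \<equiv> fst"

definition pos :: "'e set list \<Rightarrow> 'e occ \<Rightarrow> nat" where
  "pos s \<alpha> = (THE i. i < length s \<and> \<alpha> \<in> occ_step s i)"

definition before :: "'e set list \<Rightarrow> 'e occ rel" where
  "before s = {(\<alpha>, \<beta>). \<alpha> \<in> occs s \<and> \<beta> \<in> occs s \<and> pos s \<alpha> < pos s \<beta>}"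

definition not_later :: "'e set list \<Rightarrow> 'e occ rel" where
  "not_later s = {(\<alpha>, \<beta>). \<alpha> \<in> occs s \<and> \<beta> \<in> occs s \<and> \<alpha> \<noteq> \<beta> \<and> pos s \<alpha> \<le> pos s \<beta>}"

section \<open>Relational structures and their closures\<close>

type_synonym 'x rel_structure = "'x set \<times> 'x rel \<times> 'x rel"

definition prec_cl :: "'x set \<Rightarrow> 'x rel \<Rightarrow> 'x rel \<Rightarrow> 'x rel" where
  "prec_cl X R1 R2 = star_on X (R1 \<union> R2) O R1 O star_on X (R1 \<union> R2)"

definition sqsub_cl :: "'x set \<Rightarrow> 'x rel \<Rightarrow> 'x rel \<Rightarrow> 'x rel" where
  "sqsub_cl X R1 R2 = star_on X (R1 \<union> R2) - Id_on X"

fun commutative_closure :: "'x rel_structure \<Rightarrow> 'x rel_structure" where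
  "commutative_closure (X, R1, R2) =
     (let R3 = R1 \<inter> star_on X R2
      in (X, sym_cl (prec_cl X R3 R2) \<union> R1, sqsub_cl X R3 R2))"

section \<open>The structure of a step sequence\<close>

definition com_rel :: "'e gct_alphabet \<Rightarrow> 'e set list \<Rightarrow> 'e occ rel" where
  "com_rel \<Theta> s = {(\<alpha>, \<beta>). \<alpha> \<in> occs s \<and> \<beta> \<in> occs s \<and> (lab \<alpha>, lab \<beta>) \<in> inl \<Theta>}"

definition sqsub_rel :: "'e gct_alphabet \<Rightarrow> 'e set list \<Rightarrow> 'e occ rel" where
  "sqsub_rel \<Theta> s = {(\<alpha>, \<beta>). (\<alpha>, \<beta>) \<in> not_later s \<and> (lab \<beta>, lab \<alpha>) \<notin> ser \<Theta> \<union> inl \<Theta>}"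

definition prec_rel :: "'e gct_alphabet \<Rightarrow> 'e set list \<Rightarrow> 'e occ rel" where
  "prec_rel \<Theta> s =
     (let S = star_on (occs s) (sqsub_rel \<Theta> s); com = com_rel \<Theta> s
      in {(\<alpha>, \<beta>). (\<alpha>, \<beta>) \<in> before s \<and>
           ((lab \<alpha>, lab \<beta>) \<notin> ser \<Theta> \<union> inl \<Theta> \<or>
            (\<alpha>, \<beta>) \<in> com \<inter> (sym_core S O compl_on (occs s) com O sym_core S) \<or>
            (lab \<alpha>, lab \<beta>) \<in> ser \<Theta> \<and>
              (\<exists>\<delta>\<in>occs s. \<exists>\<gamma>\<in>occs s.
                 (\<delta>, \<gamma>) \<in> before s \<and> (lab \<delta>, lab \<gamma>) \<notin> ser \<Theta> \<and>
                 (\<alpha>, \<delta>) \<in> S \<and> (\<delta>, \<beta>) \<in> S \<and> (\<alpha>, \<gamma>) \<in> S \<and> (\<gamma>, \<beta>) \<in> S))})"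

definition gct_structure :: "'e gct_alphabet \<Rightarrow> 'e set list \<Rightarrow> 'e occ rel_structure" where
  "gct_structure \<Theta> s =
     commutative_closure
       (occs s, prec_rel \<Theta> s \<union> com_rel \<Theta> s, prec_rel \<Theta> s \<union> sqsub_rel \<Theta> s)"

section \<open>Stratified extensions\<close>

definition stratified_order :: "'x set \<Rightarrow> 'x rel \<Rightarrow> bool" where
  "stratified_order X lt \<longleftrightarrow>
     lt \<subseteq> X \<times> X \<and> irrefl lt \<and> trans lt \<and>
     equiv X {(a, b). a \<in> X \<and> b \<in> X \<and> (a = b \<or> ((a, b) \<notin> lt \<and> (b, a) \<notin> lt))}"

fun extensions :: "'x rel_structure \<Rightarrow> 'x rel set" where
  "extensions (X, com, sqsub) =
     {lt. stratified_order X lt \<and>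
        (\<forall>\<alpha> \<beta>. (\<alpha>, \<beta>) \<in> com \<longrightarrow> (\<alpha>, \<beta>) \<in> lt \<or> (\<beta>, \<alpha>) \<in> lt) \<and>
        (\<forall>\<alpha> \<beta>. (\<alpha>, \<beta>) \<in> sqsub \<longrightarrow> \<alpha> \<noteq> \<beta> \<and> (\<beta>, \<alpha>) \<notin> lt)}"

end

theory Submission
  imports Defs
begin

text \<open>
  Only \<open>\<sqsubset>\<^sub>s\<close>, the commutativity relation and clauses (i) and (ii) of \<open>\<prec>\<^sub>s\<close> matter: they survive every rewriting
  of \<open>s\<close>, and clause (iii) follows from them. A stratified order satisfying these constraints is an ordered
  partition of the occurrences. Splitting a block along \<open>ser\<close> is possible as long as the block is not strongly
  connected under \<open>\<sqsubset>\<^sub>s\<^sup>*\<close>, so \<open>s\<close> and any extension can both be refined to orderings of the same blocks, the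
  strongly connected components of \<open>\<sqsubset>\<^sub>s\<close>. One is then turned into the other by bubble sort. Two adjacent blocks
  in the wrong order carry only pairs that are \<open>inl\<close> or \<open>ser\<close> in both directions; clause (ii) rules out that
  both kinds occur, so the blocks can be exchanged directly or by joining and splitting them.
\<close>

section \<open>Ordered partitions\<close>

text \<open>Recursion on the list, rather than comparison of indices, lets the relation decompose
  along concatenation, the form in which rewriting acts on blocks. The order properties below rest
  on the blocks being disjoint.\<close>

fun bef :: "'x set list \<Rightarrow> 'x rel" where
  "bef [] = {}"
| "bef (X # T) = X \<times> \<Union> (set T) \<union> bef T"

fun disj_blocks :: "'x set list \<Rightarrow> bool" where
  "disj_blocks [] \<longleftrightarrow> True"
| "disj_blocks (X # T) \<longleftrightarrow> X \<inter> \<Union> (set T) = {} \<and> disj_blocks T"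

lemma bef_append: "bef (T @ U) = bef T \<union> bef U \<union> \<Union> (set T) \<times> \<Union> (set U)"
  by (induction T) auto

lemma disj_append:
  "disj_blocks (T @ U) \<longleftrightarrow> disj_blocks T \<and> disj_blocks U \<and> \<Union> (set T) \<inter> \<Union> (set U) = {}"
  by (induction T) auto

lemma bef_subset: "bef T \<subseteq> \<Union> (set T) \<times> \<Union> (set T)"
  by (induction T) auto

lemma bef_carrier: "(a, b) \<in> bef T \<Longrightarrow> a \<in> \<Union> (set T)" "(a, b) \<in> bef T \<Longrightarrow> b \<in> \<Union> (set T)"
  using bef_subset[of T] by auto

lemma bef_asym: "disj_blocks T \<Longrightarrow> (a, b) \<in> bef T \<Longrightarrow> (b, a) \<notin> bef T"
proof (induction T)
  case (Cons X T)
  then show ?case using bef_subset[of T] by auto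
qed simp

lemma bef_irrefl: "disj_blocks T \<Longrightarrow> (a, a) \<notin> bef T"
  using bef_asym by metis

text \<open>The block of \<open>b\<close> comes after that of \<open>a\<close> or, being no later
  than it, before that of \<open>c\<close>. This negative transitivity is what makes incomparability
  transitive.\<close>

lemma bef_weak: "disj_blocks T \<Longrightarrow> (a, c) \<in> bef T \<Longrightarrow> b \<in> \<Union> (set T) \<Longrightarrow> (a, b) \<in> bef T \<or> (b, c) \<in> bef T"
proof (induction T)
  case (Cons X T)
  then show ?case using bef_subset[of T] by auto
qed simp

lemma bef_trans: "disj_blocks T \<Longrightarrow> (a, b) \<in> bef T \<Longrightarrow> (b, c) \<in> bef T \<Longrightarrow> (a, c) \<in> bef T"
  using bef_weak[of T a b c] bef_asym[of T b c] bef_carrier[of b c T] by blast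

lemma unordered_block:
  "a \<in> \<Union> (set T) \<Longrightarrow> b \<in> \<Union> (set T) \<Longrightarrow> (a, b) \<notin> bef T \<Longrightarrow> (b, a) \<notin> bef T \<Longrightarrow>
    \<exists>X\<in>set T. a \<in> X \<and> b \<in> X"
  by (induction T) auto

lemma block_unordered:
  "disj_blocks T \<Longrightarrow> X \<in> set T \<Longrightarrow> a \<in> X \<Longrightarrow> b \<in> X \<Longrightarrow> (a, b) \<notin> bef T"
proof (induction T)
  case (Cons Y T)
  then show ?case using bef_subset[of T] by auto
qed simp

lemma block_unique: "disj_blocks T \<Longrightarrow> X \<in> set T \<Longrightarrow> Y \<in> set T \<Longrightarrow> a \<in> X \<Longrightarrow> a \<in> Y \<Longrightarrow> X = Y"
  by (induction T) auto

text \<open>A repeated block would be disjoint from itself, hence empty.\<close>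

lemma disj_distinct: "disj_blocks T \<Longrightarrow> {} \<notin> set T \<Longrightarrow> distinct T"
  by (induction T) auto

lemma bef_nth: "(a, b) \<in> bef T \<longleftrightarrow> (\<exists>i j. i < j \<and> j < length T \<and> a \<in> T ! i \<and> b \<in> T ! j)"
proof (induction T)
  case (Cons X T)
  show ?case
  proof
    assume "(a, b) \<in> bef (X # T)"
    then consider "a \<in> X" "b \<in> \<Union> (set T)" | "(a, b) \<in> bef T" by auto
    then show "\<exists>i j. i < j \<and> j < length (X # T) \<and> a \<in> (X # T) ! i \<and> b \<in> (X # T) ! j"
    proof cases
      case 1
      then obtain j where "j < length T" "b \<in> T ! j" by (auto simp: in_set_conv_nth)
      with 1 show ?thesis by (intro exI[of _ 0] exI[of _ "Suc j"]) auto
    next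
      case 2
      then obtain i j where "i < j" "j < length T" "a \<in> T ! i" "b \<in> T ! j" using Cons.IH by auto
      then show ?thesis by (intro exI[of _ "Suc i"] exI[of _ "Suc j"]) auto
    qed
  next
    assume "\<exists>i j. i < j \<and> j < length (X # T) \<and> a \<in> (X # T) ! i \<and> b \<in> (X # T) ! j"
    then obtain i j where ij: "i < j" "j < length (X # T)" "a \<in> (X # T) ! i" "b \<in> (X # T) ! j" by auto
    then obtain j' where j': "j = Suc j'" by (cases j) auto
    show "(a, b) \<in> bef (X # T)"
    proof (cases i)
      case 0
      with ij j' show ?thesis by auto
    next
      case (Suc i')
      with ij j' Cons.IH show ?thesis by auto
    qed
  qed
qed simp

lemma disj_nth_unique:
  assumes "disj_blocks T" "i < length T" "j < length T" "a \<in> T ! i" "a \<in> T ! j"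
  shows "i = j"
  using assms bef_irrefl[OF assms(1), of a] unfolding bef_nth
  by (metis linorder_less_linear)

section \<open>Stratified orders as ordered partitions of a finite set\<close>

lemma stratified_order_bef:
  assumes "disj_blocks T"
  shows "stratified_order (\<Union> (set T)) (bef T)"
  unfolding stratified_order_def
proof (intro conjI)
  show "bef T \<subseteq> \<Union> (set T) \<times> \<Union> (set T)" by (rule bef_subset)
  show "irrefl (bef T)" using bef_irrefl[OF assms] by (auto simp: irrefl_def)
  show "trans (bef T)" using bef_trans[OF assms] by (blast intro: transI)
  show "equiv (\<Union> (set T)) {(a, b). a \<in> \<Union> (set T) \<and> b \<in> \<Union> (set T) \<and>
      (a = b \<or> (a, b) \<notin> bef T \<and> (b, a) \<notin> bef T)}"
    (is "equiv _ ?E")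
  proof (rule equivI)
    show "?E \<subseteq> \<Union> (set T) \<times> \<Union> (set T)" by auto
    show "refl_on (\<Union> (set T)) ?E" by (auto simp: refl_on_def)
    show "sym ?E" by (auto simp: sym_def)
    show "trans ?E"
      unfolding trans_def using bef_weak[OF assms] by (clarsimp, metis)
  qed
qed

lemma stratified_order_weak:
  assumes "stratified_order X lt" "(a, c) \<in> lt" "b \<in> X"
  shows "(a, b) \<in> lt \<or> (b, c) \<in> lt"
proof (rule ccontr)
  assume neg: "\<not> ?thesis"
  let ?E = "{(a, b). a \<in> X \<and> b \<in> X \<and> (a = b \<or> (a, b) \<notin> lt \<and> (b, a) \<notin> lt)}"
  have lt: "lt \<subseteq> X \<times> X" "irrefl lt" "trans lt" and "trans ?E"
    using assms(1) by (auto simp: stratified_order_def equiv_def)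
  \<comment> \<open>By transitivity with \<open>(a, c)\<close>, a pair \<open>(b, a)\<close> in
    \<open>lt\<close> would give \<open>(b, c)\<close>, and a pair \<open>(c, b)\<close> would give
    \<open>(a, b)\<close>. So if both alternatives fail, both pairs are incomparable.\<close>
  have "(a, b) \<in> ?E" "(b, c) \<in> ?E"
    using neg assms lt by (auto dest: transD)
  with \<open>trans ?E\<close> have "(a, c) \<in> ?E" by (rule transD)
  then show False using assms(2) lt(2) by (auto simp: irrefl_def)
qed

text \<open>The minimal elements form the first block; the rest is partitioned by induction.
  Negative transitivity guarantees that the whole first block precedes everything else.\<close>

lemma ordered_partition_exists:
  assumes "finite X" "lt \<subseteq> X \<times> X" "irrefl lt" "trans lt"
    and "\<And>a b c. (a, c) \<in> lt \<Longrightarrow> b \<in> X \<Longrightarrow> (a, b) \<in> lt \<or> (b, c) \<in> lt"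
  shows "\<exists>T. \<Union> (set T) = X \<and> {} \<notin> set T \<and> disj_blocks T \<and> bef T = lt"
  using assms
proof (induction X arbitrary: lt rule: finite_psubset_induct)
  case (psubset X)
  note weak = psubset.prems(4)
  show ?case
  proof (cases "X = {}")
    case True
    with psubset.prems show ?thesis by (intro exI[of _ "[]"]) auto
  next
    case False
    define M where "M = {x \<in> X. \<forall>y. (y, x) \<notin> lt}"
    have "finite lt" using psubset.prems(1) psubset.hyps finite_subset by blast
    moreover have "acyclic lt"
      using psubset.prems(2,3) by (simp add: acyclic_irrefl trancl_id)
    ultimately have "wf lt" by (rule finite_acyclic_wf)
    obtain x where "x \<in> X" using False by auto
    with \<open>wf lt\<close> obtain m where "m \<in> X" "\<And>y. (y, m) \<in> lt \<Longrightarrow> y \<notin> X"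
      by (rule wfE_min) blast
    then have "M \<noteq> {}" using psubset.prems(1) by (auto simp: M_def)
    define lt' where "lt' = lt \<inter> (X - M) \<times> (X - M)"
    have "X - M \<subset> X" using \<open>M \<noteq> {}\<close> by (auto simp: M_def)
    moreover have "irrefl lt'" using psubset.prems(2) by (auto simp: lt'_def irrefl_def)
    moreover have "trans lt'" using psubset.prems(3) by (auto simp: lt'_def trans_def)
    moreover have "(a, b) \<in> lt' \<or> (b, c) \<in> lt'" if "(a, c) \<in> lt'" "b \<in> X - M" for a b c
      using weak[of a c b] that by (auto simp: lt'_def)
    ultimately obtain T where T: "\<Union> (set T) = X - M" "{} \<notin> set T" "disj_blocks T" "bef T = lt'"
      using psubset.IH[of "X - M" lt'] by (auto simp: lt'_def)
    \<comment> \<open>An element \<open>c\<close> outside \<open>M\<close> has a predecessor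
      \<open>y\<close>. Comparing a minimal \<open>m\<close> with the pair \<open>(y, c)\<close>
      leaves only \<open>(m, c)\<close>, since nothing precedes \<open>m\<close>.\<close>
    have "M \<times> (X - M) \<subseteq> lt"
      using weak by (fastforce simp: M_def)
    then have "bef (M # T) = lt"
      using T(1,4) psubset.prems(1) by (auto simp: lt'_def M_def)
    with T \<open>M \<noteq> {}\<close> show ?thesis
      by (intro exI[of _ "M # T"]) (auto simp: M_def)
  qed
qed

section \<open>Step sequences as ordered partitions of their occurrences\<close>

text \<open>The counter \<open>n\<close> gives the number of earlier occurrences of each event.\<close>

fun occ_seq :: "('e \<Rightarrow> nat) \<Rightarrow> 'e set list \<Rightarrow> 'e occ set list" where
  "occ_seq n [] = []"
| "occ_seq n (A # s) = {(e, n e + 1) | e. e \<in> A} # occ_seq (\<lambda>e. n e + (if e \<in> A then 1 else 0)) s"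

lemma occ_count_Nil [simp]: "occ_count [] e = 0"
  by (simp add: occ_count_def)

lemma occ_count_Cons: "occ_count (A # s) e = (if e \<in> A then 1 else 0) + occ_count s e"
  unfolding occ_count_def length_filter_conv_card[symmetric] by simp

lemma length_occ_seq [simp]: "length (occ_seq n s) = length s"
  by (induction s arbitrary: n) auto

lemma occ_seq_nth:
  "i < length s \<Longrightarrow> occ_seq n s ! i = {(e, n e + occ_count (take i s) e + 1) | e. e \<in> s ! i}"
proof (induction s arbitrary: n i)
  case (Cons A s)
  then show ?case by (cases i) (auto simp: occ_count_Cons)
qed simp

lemma occ_seq_occ_step: "i < length s \<Longrightarrow> occ_seq (\<lambda>_. 0) s ! i = occ_step s i"
  by (simp add: occ_seq_nth occ_step_def)

lemma occ_seq_append: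
  "occ_seq n (w @ z) = occ_seq n w @ occ_seq (\<lambda>e. n e + occ_count w e) z"
  by (induction w arbitrary: n) (auto simp: occ_count_Cons add.assoc)

lemma image_occ_seq: "map (image lab) (occ_seq n s) = s"
  by (induction s arbitrary: n) (auto simp: image_def)

lemma occ_seq_gt: "(e, j) \<in> \<Union> (set (occ_seq n s)) \<Longrightarrow> n e < j"
proof (induction s arbitrary: n)
  case (Cons A s)
  show ?case
  proof (cases "(e, j) \<in> \<Union> (set (occ_seq (\<lambda>e. n e + (if e \<in> A then 1 else 0)) s))")
    case True
    from Cons.IH[OF this] show ?thesis by simp
  next
    case False
    with Cons.prems show ?thesis by auto
  qed
qed simp

lemma disj_occ_seq: "disj_blocks (occ_seq n s)"
proof (induction s arbitrary: n)
  case (Cons A s)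
  have False if "(e, n e + 1) \<in> \<Union> (set (occ_seq (\<lambda>e. n e + (if e \<in> A then 1 else 0)) s))" "e \<in> A" for e
    using occ_seq_gt[OF that(1)] that(2) by simp
  with Cons.IH show ?case by auto
qed simp

text \<open>A step contributes at most one occurrence of each event and the counter grows by one
  each time, so no number between \<open>n e\<close> and \<open>j\<close> is skipped. In particular
  \<open>(e, k)\<close> does occur.\<close>

lemma occ_seq_label_order:
  assumes "(e, j) \<in> \<Union> (set (occ_seq n s))" "n e < k" "k < j"
  shows "((e, k), (e, j)) \<in> bef (occ_seq n s)"
  using assms
proof (induction s arbitrary: n)
  case (Cons A s)
  let ?n = "\<lambda>e. n e + (if e \<in> A then 1 else 0)"
  have j: "(e, j) \<in> \<Union> (set (occ_seq ?n s))" using Cons.prems by auto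
  show ?case
  proof (cases "?n e < k")
    case True
    from Cons.IH[OF j this Cons.prems(3)] show ?thesis by simp
  next
    case False
    then have "e \<in> A" "k = n e + 1" using Cons.prems(2) by (auto split: if_splits)
    with j show ?thesis by auto
  qed
qed simp

text \<open>A converse of \<open>image_occ_seq\<close>: numbering is recovered from the labels alone
  when the occurrences of each event start just above the counter and appear without gaps in
  increasing order.\<close>

lemma occ_seq_image:
  assumes "disj_blocks T"
    and "\<And>e j. (e, j) \<in> \<Union> (set T) \<Longrightarrow> n e < j"
    and "\<And>e j k. (e, j) \<in> \<Union> (set T) \<Longrightarrow> n e < k \<Longrightarrow> k < j \<Longrightarrow> ((e, k), (e, j)) \<in> bef T"
  shows "occ_seq n (map (image lab) T) = T"
  using assms
proof (induction T arbitrary: n)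
  case (Cons X T)
  have d: "X \<inter> \<Union> (set T) = {}" "disj_blocks T" using Cons.prems(1) by auto
  \<comment> \<open>A larger number would require the occurrence numbered \<open>n e + 1\<close> in
    a block strictly before the first one.\<close>
  have X: "j = n e + 1" if "(e, j) \<in> X" for e j
  proof (rule ccontr)
    assume "j \<noteq> n e + 1"
    moreover have "n e < j" using Cons.prems(2) that by auto
    ultimately have "((e, n e + 1), (e, j)) \<in> bef (X # T)"
      using Cons.prems(3)[of e j "n e + 1"] that by auto
    with that d bef_carrier[of _ "(e, j)" T] show False by auto
  qed
  then have fst_X: "(e, n e + 1) \<in> X" if "e \<in> lab ` X" for e using that by fastforce
  with X have X': "{(e, n e + 1) | e. e \<in> lab ` X} = X" by force
  let ?n = "\<lambda>e. n e + (if e \<in> lab ` X then 1 else 0)"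
  have "occ_seq ?n (map (image lab) T) = T"
  proof (rule Cons.IH[OF d(2)])
    fix e j assume j: "(e, j) \<in> \<Union> (set T)"
    then have "n e < j" using Cons.prems(2) by auto
    moreover have "j \<noteq> n e + 1" if "e \<in> lab ` X" using fst_X[OF that] j d by auto
    ultimately show "?n e < j" by (cases "e \<in> lab ` X") simp_all
    fix k assume k: "?n e < k" "k < j"
    then have "((e, k), (e, j)) \<in> bef (X # T)" using Cons.prems(3)[of e j k] j by (auto split: if_splits)
    moreover have "(e, k) \<notin> X" using X[of e k] k(1) by (force split: if_splits)
    ultimately show "((e, k), (e, j)) \<in> bef T" by auto
  qed
  with X' show ?case by simp
qed simp

lemma occs_occ_seq: "occs s = \<Union> (set (occ_seq (\<lambda>_. 0) s))"
  unfolding occs_def by (force simp: set_conv_nth occ_seq_occ_step)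

text \<open>Disjointness of the blocks supplies the uniqueness demanded by the definite description
  in \<open>pos\<close>.\<close>

lemma pos_eqI:
  assumes "i < length s" "\<alpha> \<in> occ_seq (\<lambda>_. 0) s ! i"
  shows "pos s \<alpha> = i"
  unfolding pos_def
proof (rule the_equality)
  show "i < length s \<and> \<alpha> \<in> occ_step s i" using assms by (simp add: occ_seq_occ_step)
  show "j = i" if "j < length s \<and> \<alpha> \<in> occ_step s j" for j
    using disj_nth_unique[OF disj_occ_seq[of "\<lambda>_. 0" s], of j i \<alpha>] that assms
    by (simp add: occ_seq_occ_step)
qed

lemma occs_pos:
  assumes "\<alpha> \<in> occs s"
  shows "pos s \<alpha> < length s" "\<alpha> \<in> occ_seq (\<lambda>_. 0) s ! pos s \<alpha>"
proof -
  obtain i where "i < length s" "\<alpha> \<in> occ_seq (\<lambda>_. 0) s ! i"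
    using assms by (auto simp: occs_occ_seq in_set_conv_nth)
  then show "pos s \<alpha> < length s" "\<alpha> \<in> occ_seq (\<lambda>_. 0) s ! pos s \<alpha>" by (simp_all add: pos_eqI)
qed

lemma before_bef: "before s = bef (occ_seq (\<lambda>_. 0) s)"
proof -
  have "(\<alpha>, \<beta>) \<in> before s \<longleftrightarrow> (\<alpha>, \<beta>) \<in> bef (occ_seq (\<lambda>_. 0) s)" for \<alpha> \<beta>
  proof
    assume "(\<alpha>, \<beta>) \<in> before s"
    then show "(\<alpha>, \<beta>) \<in> bef (occ_seq (\<lambda>_. 0) s)"
      using occs_pos[of \<alpha> s] occs_pos[of \<beta> s] unfolding before_def bef_nth by auto
  next
    assume ab: "(\<alpha>, \<beta>) \<in> bef (occ_seq (\<lambda>_. 0) s)"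
    then obtain i j where ij: "i < j" "j < length s"
      "\<alpha> \<in> occ_seq (\<lambda>_. 0) s ! i" "\<beta> \<in> occ_seq (\<lambda>_. 0) s ! j"
      by (auto simp: bef_nth)
    then have "pos s \<alpha> = i" "pos s \<beta> = j" by (auto intro: pos_eqI)
    with ij bef_carrier[OF ab] show "(\<alpha>, \<beta>) \<in> before s"
      by (auto simp: before_def occs_occ_seq)
  qed
  then show ?thesis by auto
qed

lemma not_later_iff:
  "(\<alpha>, \<beta>) \<in> not_later s \<longleftrightarrow> \<alpha> \<in> occs s \<and> \<beta> \<in> occs s \<and> \<alpha> \<noteq> \<beta> \<and> (\<beta>, \<alpha>) \<notin> before s"
  by (auto simp: not_later_def before_def)

lemma finite_occs:
  assumes "finite (events \<Theta>)" "s \<in> step_seqs \<Theta>"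
  shows "finite (occs s)"
proof -
  have "finite A" if "A \<in> set s" for A
    using that assms by (auto simp: step_seqs_def lists_eq_set steps_def intro: finite_subset)
  then have "finite (occ_step s i)" if "i < length s" for i
    using that by (auto simp: occ_step_def)
  then show ?thesis by (auto simp: occs_def)
qed

declare split_paired_All [simp del] split_paired_Ex [simp del]

section \<open>Rewriting of ordered partitions\<close>

text \<open>This is \<open>gct_rewrite\<close> lifted from events to occurrences, so that a block
  keeps its identity while it moves. That the labels of blocks form steps is supplied separately by
  \<open>compat\<close>.\<close>

inductive occ_rewrite :: "'e gct_alphabet \<Rightarrow> 'e occ set list \<Rightarrow> 'e occ set list \<Rightarrow> bool" for \<Theta> where
  split: "X \<noteq> {} \<Longrightarrow> Y \<noteq> {} \<Longrightarrow> \<forall>\<alpha>\<in>X. \<forall>\<beta>\<in>Y. (lab \<alpha>, lab \<beta>) \<in> ser \<Theta> \<Longrightarrow>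
    occ_rewrite \<Theta> (W @ [X \<union> Y] @ Z) (W @ [X, Y] @ Z)"
| swap: "X \<noteq> {} \<Longrightarrow> Y \<noteq> {} \<Longrightarrow> \<forall>\<alpha>\<in>X. \<forall>\<beta>\<in>Y. (lab \<alpha>, lab \<beta>) \<in> inl \<Theta> \<Longrightarrow>
    occ_rewrite \<Theta> (W @ [X, Y] @ Z) (W @ [Y, X] @ Z)"

section \<open>Compatible partitions and their invariance under rewriting\<close>

locale gct_seq =
  fixes \<Theta> :: "'e gct_alphabet" and s :: "'e set list"
  assumes alphabet: "gcomtrace_alphabet \<Theta>" and s: "s \<in> step_seqs \<Theta>"
begin

abbreviation "\<Omega> \<equiv> occs s"

abbreviation "T\<^sub>0 \<equiv> occ_seq (\<lambda>_. 0) s"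

definition sqs where "sqs = star_on \<Omega> (sqsub_rel \<Theta> s)"

text \<open>The pairs \<open>\<alpha> \<prec>\<^sub>s \<beta>\<close> obtained from clause (ii).\<close>

definition forced where
  "forced = {(\<alpha>, \<beta>). (\<alpha>, \<beta>) \<in> before s \<and> (lab \<alpha>, lab \<beta>) \<in> inl \<Theta> \<and>
     (\<exists>\<gamma>\<in>\<Omega>. \<exists>\<delta>\<in>\<Omega>. (\<alpha>, \<gamma>) \<in> sqs \<and> (\<gamma>, \<alpha>) \<in> sqs \<and> (\<delta>, \<beta>) \<in> sqs \<and> (\<beta>, \<delta>) \<in> sqs \<and>
        (lab \<gamma>, lab \<delta>) \<notin> inl \<Theta>)}"

text \<open>The invariant of rewriting. The agreement with \<open>before s\<close> is an equivalence
  because it encodes two constraints: from right to left it is clause (i), from left to right it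
  forbids reversing an edge of \<open>sqsub_rel\<close>. The condition on \<open>sim\<close> makes
  each block a step.\<close>

definition compat where
  "compat T \<longleftrightarrow> \<Union> (set T) = \<Omega> \<and> {} \<notin> set T \<and> disj_blocks T \<and>
     (\<forall>X\<in>set T. \<forall>\<alpha>\<in>X. \<forall>\<beta>\<in>X. \<alpha> \<noteq> \<beta> \<longrightarrow> (lab \<alpha>, lab \<beta>) \<in> sim \<Theta>) \<and>
     (\<forall>\<alpha>\<in>\<Omega>. \<forall>\<beta>\<in>\<Omega>. (lab \<alpha>, lab \<beta>) \<notin> ser \<Theta> \<union> inl \<Theta> \<longrightarrow>
        (\<alpha>, \<beta>) \<in> bef T \<longleftrightarrow> (\<alpha>, \<beta>) \<in> before s) \<and>
     forced \<subseteq> bef T"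

lemma ser_sim: "(a, b) \<in> ser \<Theta> \<Longrightarrow> (a, b) \<in> sim \<Theta>"
  and sim_sym: "(a, b) \<in> sim \<Theta> \<Longrightarrow> (b, a) \<in> sim \<Theta>"
  and inl_sym: "(a, b) \<in> inl \<Theta> \<Longrightarrow> (b, a) \<in> inl \<Theta>"
  and sim_irrefl: "(a, a) \<notin> sim \<Theta>"
  and inl_irrefl: "(a, a) \<notin> inl \<Theta>"
  and sim_not_inl: "(a, b) \<in> sim \<Theta> \<Longrightarrow> (a, b) \<notin> inl \<Theta>"
  using alphabet by (auto simp: gcomtrace_alphabet_def irrefl_def dest: symD)

lemma ser_irrefl: "(a, a) \<notin> ser \<Theta>"
  using ser_sim sim_irrefl by blast

lemma compatD:
  assumes "compat T"
  shows compat_Union: "\<Union> (set T) = \<Omega>" and compat_nonempty: "{} \<notin> set T"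
    and compat_disj: "disj_blocks T"
    and compat_sim: "X \<in> set T \<Longrightarrow> \<alpha> \<in> X \<Longrightarrow> \<beta> \<in> X \<Longrightarrow> \<alpha> \<noteq> \<beta> \<Longrightarrow> (lab \<alpha>, lab \<beta>) \<in> sim \<Theta>"
    and compat_agree: "\<alpha> \<in> \<Omega> \<Longrightarrow> \<beta> \<in> \<Omega> \<Longrightarrow> (lab \<alpha>, lab \<beta>) \<notin> ser \<Theta> \<Longrightarrow> (lab \<alpha>, lab \<beta>) \<notin> inl \<Theta> \<Longrightarrow>
      (\<alpha>, \<beta>) \<in> bef T \<longleftrightarrow> (\<alpha>, \<beta>) \<in> before s"
    and compat_forced: "(\<alpha>, \<beta>) \<in> forced \<Longrightarrow> (\<alpha>, \<beta>) \<in> bef T"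
  using assms unfolding compat_def by blast+

lemma before_occs: "(\<alpha>, \<beta>) \<in> before s \<Longrightarrow> \<alpha> \<in> \<Omega> \<and> \<beta> \<in> \<Omega>"
  by (simp add: before_def)

lemma sqsub_rel_iff:
  "(\<alpha>, \<beta>) \<in> sqsub_rel \<Theta> s \<longleftrightarrow> \<alpha> \<in> \<Omega> \<and> \<beta> \<in> \<Omega> \<and> \<alpha> \<noteq> \<beta> \<and> (\<beta>, \<alpha>) \<notin> before s \<and>
     (lab \<beta>, lab \<alpha>) \<notin> ser \<Theta> \<and> (lab \<beta>, lab \<alpha>) \<notin> inl \<Theta>"
  by (auto simp: sqsub_rel_def not_later_iff)

lemma sqs_refl: "\<alpha> \<in> \<Omega> \<Longrightarrow> (\<alpha>, \<alpha>) \<in> sqs"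
  by (auto simp: sqs_def star_on_def)

lemma sqs_step: "(\<alpha>, \<beta>) \<in> sqs \<Longrightarrow> (\<beta>, \<gamma>) \<in> sqsub_rel \<Theta> s \<Longrightarrow> (\<alpha>, \<gamma>) \<in> sqs"
  by (auto simp: sqs_def star_on_def intro: trancl_into_trancl)

text \<open>In a stratified order the relation "not greater" is reflexive and transitive on the
  carrier, so it passes from \<open>R\<close> to its closure.\<close>

lemma star_on_not_greater:
  assumes "stratified_order X lt" "(a, b) \<in> star_on X R"
    and "\<And>a b. (a, b) \<in> R \<Longrightarrow> a \<in> X \<and> b \<in> X \<and> (b, a) \<notin> lt"
  shows "a \<in> X \<and> b \<in> X \<and> (b, a) \<notin> lt"
proof -
  have "a \<in> X \<and> b \<in> X \<and> (b, a) \<notin> lt" if "(a, b) \<in> R\<^sup>+"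
    using that
  proof induction
    case (base y)
    then show ?case by (rule assms(3))
  next
    case (step y z)
    with assms(3)[OF step.hyps(2)] stratified_order_weak[OF assms(1), of z a y] show ?case by blast
  qed
  with assms(1,2) show ?thesis by (auto simp: star_on_def stratified_order_def irrefl_def)
qed

lemma compat_stratified: "compat T \<Longrightarrow> stratified_order \<Omega> (bef T)"
  using stratified_order_bef[OF compat_disj] compat_Union by metis

lemma compat_sqs:
  assumes "compat T" "(\<alpha>, \<beta>) \<in> sqs"
  shows "\<alpha> \<in> \<Omega>" "\<beta> \<in> \<Omega>" "(\<beta>, \<alpha>) \<notin> bef T"
  using star_on_not_greater[OF compat_stratified[OF assms(1)] assms(2)[unfolded sqs_def]]
  by (auto simp: sqsub_rel_iff compat_agree[OF assms(1)])

lemma compat_same_block: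
  assumes "compat T" "\<alpha> \<in> \<Omega>" "\<beta> \<in> \<Omega>" "(\<alpha>, \<beta>) \<notin> bef T" "(\<beta>, \<alpha>) \<notin> bef T"
  shows "\<exists>X\<in>set T. \<alpha> \<in> X \<and> \<beta> \<in> X"
  using unordered_block[of \<alpha> T \<beta>] assms compat_Union[OF assms(1)] by simp

text \<open>Two unordered occurrences share a block, so they are equal or related by
  \<open>sim\<close>; \<open>inl\<close> is irreflexive and disjoint from
  \<open>sim\<close>.\<close>

lemma compat_inl_ordered:
  assumes "compat T" "\<alpha> \<in> \<Omega>" "\<beta> \<in> \<Omega>" "(lab \<alpha>, lab \<beta>) \<in> inl \<Theta>"
  shows "(\<alpha>, \<beta>) \<in> bef T \<or> (\<beta>, \<alpha>) \<in> bef T"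
  using compat_same_block[OF assms(1-3)] compat_sim[OF assms(1)] sim_not_inl inl_irrefl assms(4)
  by metis

text \<open>Only pairs between \<open>X\<close> and \<open>Y\<close> change, and their labels are in
  \<open>inl\<close>, so agreement with \<open>s\<close> is unaffected. The danger is a forced pair
  across the two blocks. Its witnesses \<gamma> and \<delta> are mutually reachable from \<alpha>
  and \<beta>, hence lie in \<open>X\<close> and \<open>Y\<close> themselves, where all cross pairs
  are in \<open>inl\<close>.\<close>

lemma compat_rewrite_swap:
  assumes c: "compat (W @ [X, Y] @ Z)" and inl: "\<forall>\<alpha>\<in>X. \<forall>\<beta>\<in>Y. (lab \<alpha>, lab \<beta>) \<in> inl \<Theta>"
  shows "compat (W @ [Y, X] @ Z)"
proof -
  let ?T = "W @ [X, Y] @ Z" and ?U = "W @ [Y, X] @ Z"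
  \<comment> \<open>The pairs whose order the exchange leaves alone.\<close>
  define K where
    "K = bef W \<union> bef Z \<union> \<Union> (set W) \<times> (X \<union> Y \<union> \<Union> (set Z)) \<union> (X \<union> Y) \<times> \<Union> (set Z)"
  have bef: "bef ?T = K \<union> X \<times> Y" "bef ?U = K \<union> Y \<times> X"
    by (auto simp: K_def bef_append)
  have "(\<alpha>, \<beta>) \<in> bef ?U" if f: "(\<alpha>, \<beta>) \<in> forced" for \<alpha> \<beta>
  proof (rule ccontr)
    assume "(\<alpha>, \<beta>) \<notin> bef ?U"
    with compat_forced[OF c f] bef have \<alpha>: "\<alpha> \<in> X" and \<beta>: "\<beta> \<in> Y" by blast+
    from f obtain \<gamma> \<delta> where \<gamma>: "(\<alpha>, \<gamma>) \<in> sqs" "(\<gamma>, \<alpha>) \<in> sqs" and \<delta>: "(\<delta>, \<beta>) \<in> sqs" "(\<beta>, \<delta>) \<in> sqs"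
      and "(lab \<gamma>, lab \<delta>) \<notin> inl \<Theta>" by (auto simp: forced_def)
    moreover have "\<gamma> \<in> X"
      using compat_same_block[OF c, of \<alpha> \<gamma>] compat_sqs[OF c \<gamma>(1)] compat_sqs[OF c \<gamma>(2)]
        block_unique[OF compat_disj[OF c], of X _ \<alpha>] \<alpha> by auto
    moreover have "\<delta> \<in> Y"
      using compat_same_block[OF c, of \<beta> \<delta>] compat_sqs[OF c \<delta>(1)] compat_sqs[OF c \<delta>(2)]
        block_unique[OF compat_disj[OF c], of Y _ \<beta>] \<beta> by auto
    ultimately show False using inl by blast
  qed
  moreover have "(\<alpha>, \<beta>) \<in> bef ?U \<longleftrightarrow> (\<alpha>, \<beta>) \<in> before s"
    if "\<alpha> \<in> \<Omega>" "\<beta> \<in> \<Omega>" "(lab \<alpha>, lab \<beta>) \<notin> ser \<Theta> \<union> inl \<Theta>" for \<alpha> \<beta>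
    using compat_agree[OF c, of \<alpha> \<beta>] that inl inl_sym bef by blast
  moreover have set: "set ?U = set ?T" by auto
  moreover have "disj_blocks ?U" using compat_disj[OF c] by (auto simp: disj_append)
  moreover note compat_Union[OF c] compat_nonempty[OF c] compat_sim[OF c]
  ultimately show ?thesis
    unfolding compat_def set by (intro conjI ballI impI subrelI)
qed

text \<open>The split adds exactly the pairs of \<open>X \<times> Y\<close>. Their labels are in
  \<open>ser\<close>, so they are exempt from agreement, and they are not forced because
  \<open>ser\<close> lies in \<open>sim\<close> and forced pairs are in \<open>inl\<close>. For the
  joined block, symmetry of \<open>sim\<close> covers the cross pairs.\<close>

lemma compat_rewrite_split:
  assumes ne: "X \<noteq> {}" "Y \<noteq> {}" and ser: "\<forall>\<alpha>\<in>X. \<forall>\<beta>\<in>Y. (lab \<alpha>, lab \<beta>) \<in> ser \<Theta>"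
  shows "compat (W @ [X \<union> Y] @ Z) \<longleftrightarrow> compat (W @ [X, Y] @ Z)"
proof -
  let ?T = "W @ [X \<union> Y] @ Z" and ?U = "W @ [X, Y] @ Z"
  have bef: "bef ?U = bef ?T \<union> X \<times> Y"
    by (auto simp: bef_append)
  have "X \<inter> Y = {}" using ser ser_irrefl by blast
  then have disj: "disj_blocks ?T \<longleftrightarrow> disj_blocks ?U" by (auto simp: disj_append)
  have sim: "(\<forall>\<alpha>\<in>X \<union> Y. \<forall>\<beta>\<in>X \<union> Y. \<alpha> \<noteq> \<beta> \<longrightarrow> (lab \<alpha>, lab \<beta>) \<in> sim \<Theta>) \<longleftrightarrow>
      (\<forall>\<alpha>\<in>X. \<forall>\<beta>\<in>X. \<alpha> \<noteq> \<beta> \<longrightarrow> (lab \<alpha>, lab \<beta>) \<in> sim \<Theta>) \<and>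
      (\<forall>\<alpha>\<in>Y. \<forall>\<beta>\<in>Y. \<alpha> \<noteq> \<beta> \<longrightarrow> (lab \<alpha>, lab \<beta>) \<in> sim \<Theta>)"
    using ser ser_sim sim_sym by blast
  have agree: "(\<alpha>, \<beta>) \<in> bef ?T \<longleftrightarrow> (\<alpha>, \<beta>) \<in> bef ?U" if "(lab \<alpha>, lab \<beta>) \<notin> ser \<Theta> \<union> inl \<Theta>" for \<alpha> \<beta>
    using that ser bef by blast
  have forced: "forced \<subseteq> bef ?T \<longleftrightarrow> forced \<subseteq> bef ?U"
    using bef ser ser_sim sim_not_inl unfolding forced_def by blast
  have blocks: "(\<forall>V\<in>set ?T. P V) \<longleftrightarrow> (\<forall>V\<in>set W \<union> set Z. P V) \<and> P (X \<union> Y)"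
    "(\<forall>V\<in>set ?U. P V) \<longleftrightarrow> (\<forall>V\<in>set W \<union> set Z. P V) \<and> P X \<and> P Y" for P
    by auto
  have "\<Union> (set ?T) = \<Union> (set ?U)" "{} \<in> set ?T \<longleftrightarrow> {} \<in> set ?U" using ne by auto
  moreover have "(\<forall>\<alpha>\<in>\<Omega>. \<forall>\<beta>\<in>\<Omega>. (lab \<alpha>, lab \<beta>) \<notin> ser \<Theta> \<union> inl \<Theta> \<longrightarrow>
      (\<alpha>, \<beta>) \<in> bef ?T \<longleftrightarrow> (\<alpha>, \<beta>) \<in> before s) \<longleftrightarrow>
    (\<forall>\<alpha>\<in>\<Omega>. \<forall>\<beta>\<in>\<Omega>. (lab \<alpha>, lab \<beta>) \<notin> ser \<Theta> \<union> inl \<Theta> \<longrightarrow>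
      (\<alpha>, \<beta>) \<in> bef ?U \<longleftrightarrow> (\<alpha>, \<beta>) \<in> before s)"
    using agree by simp
  ultimately show ?thesis
    unfolding compat_def blocks sim disj forced by argo
qed

lemma compat_rewrite: "occ_rewrite \<Theta> T U \<Longrightarrow> compat T \<longleftrightarrow> compat U"
proof (induction rule: occ_rewrite.induct)
  case (split X Y W Z)
  then show ?case by (rule compat_rewrite_split)
next
  case (swap X Y W Z)
  then show ?case
    using compat_rewrite_swap[of W X Y Z] compat_rewrite_swap[of W Y X Z] inl_sym by blast
qed

section \<open>Transfer between step sequences and partitions of occurrences\<close>

lemma occ_rewrite_occ_seq:
  assumes "(u, v) \<in> gct_rewrite \<Theta>"
  shows "occ_rewrite \<Theta> (occ_seq n u) (occ_seq n v)"
proof -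
  consider (split) w B C z where "u = w @ [B \<union> C] @ z" "v = w @ [B, C] @ z"
      "B \<in> steps \<Theta>" "C \<in> steps \<Theta>" "B \<times> C \<subseteq> ser \<Theta>"
    | (swap) w A B z where "u = w @ [A, B] @ z" "v = w @ [B, A] @ z"
      "A \<in> steps \<Theta>" "B \<in> steps \<Theta>" "A \<times> B \<subseteq> inl \<Theta>"
    using assms unfolding gct_rewrite_def by blast
  then show ?thesis
  proof cases
    case split
    let ?n = "\<lambda>e. n e + occ_count w e"
    let ?f = "\<lambda>A. {(e, ?n e + 1) | e. e \<in> A}"
    let ?W = "occ_seq n w" and ?Z = "occ_seq (\<lambda>e. ?n e + (if e \<in> B \<union> C then 1 else 0)) z"
    \<comment> \<open>Disjointness means that placing \<open>B\<close> first does not raise the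
      counter of any event in \<open>C\<close>, so all occurrences keep their numbers.\<close>
    have "B \<inter> C = {}" using split(5) ser_irrefl by blast
    then have "occ_seq n v = ?W @ [?f B, ?f C] @ ?Z"
      unfolding split(2) occ_seq_append
      by (auto simp: occ_count_Cons intro!: arg_cong[where f = "\<lambda>k. occ_seq k z"] ext)
    moreover have "occ_seq n u = ?W @ [?f B \<union> ?f C] @ ?Z"
      unfolding split(1) occ_seq_append by (auto simp: occ_count_Cons)
    ultimately show ?thesis
      using split(3-5) by (simp only:) (rule occ_rewrite.split, auto simp: steps_def)
  next
    case swap
    let ?n = "\<lambda>e. n e + occ_count w e"
    let ?f = "\<lambda>A. {(e, ?n e + 1) | e. e \<in> A}"
    let ?W = "occ_seq n w" and ?Z = "occ_seq (\<lambda>e. ?n e + (if e \<in> A \<union> B then 1 else 0)) z"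
    have "A \<inter> B = {}" using swap(5) inl_irrefl by blast
    then have "occ_seq n v = ?W @ [?f B, ?f A] @ ?Z" "occ_seq n u = ?W @ [?f A, ?f B] @ ?Z"
      unfolding swap(1,2) occ_seq_append
      by (auto simp: occ_count_Cons intro!: arg_cong[where f = "\<lambda>k. occ_seq k z"] ext)
    then show ?thesis
      using swap(3-5) by (simp only:) (rule occ_rewrite.swap, auto simp: steps_def)
  qed
qed

lemma occ_seq_blocks:
  assumes "X \<in> set (occ_seq n s)"
  obtains A m where "A \<in> steps \<Theta>" "X = {(e, m e + 1) | e. e \<in> A}"
proof -
  obtain i where i: "i < length s" "X = occ_seq n s ! i"
    using assms by (auto simp: in_set_conv_nth)
  show thesis
  proof (rule that)
    show "s ! i \<in> steps \<Theta>" using s i by (auto simp: step_seqs_def)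
    show "X = {(e, (n e + occ_count (take i s) e) + 1) | e. e \<in> s ! i}"
      using i by (simp add: occ_seq_nth)
  qed
qed

lemma occs_events: "\<alpha> \<in> \<Omega> \<Longrightarrow> lab \<alpha> \<in> events \<Theta>"
  unfolding occs_occ_seq by (auto elim!: occ_seq_blocks simp: steps_def)

lemma compat_start: "compat T\<^sub>0"
proof -
  have "{} \<notin> set T\<^sub>0" by (auto elim!: occ_seq_blocks simp: steps_def)
  moreover have "(lab \<alpha>, lab \<beta>) \<in> sim \<Theta>" if "X \<in> set T\<^sub>0" "\<alpha> \<in> X" "\<beta> \<in> X" "\<alpha> \<noteq> \<beta>" for X \<alpha> \<beta>
    using that(1)
  proof (rule occ_seq_blocks)
    fix A m assume A: "A \<in> steps \<Theta>" "X = {(e, m e + 1) | e. e \<in> A}"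
    \<comment> \<open>Within one block the label determines the occurrence.\<close>
    with that have "lab \<alpha> \<in> A" "lab \<beta> \<in> A" "lab \<alpha> \<noteq> lab \<beta>" by auto
    with A(1) show "(lab \<alpha>, lab \<beta>) \<in> sim \<Theta>" by (auto simp: steps_def)
  qed
  ultimately show ?thesis
    by (auto simp: compat_def occs_occ_seq disj_occ_seq before_bef forced_def)
qed

lemma compat_class:
  assumes "u \<in> gct_class \<Theta> s"
  shows "compat (occ_seq (\<lambda>_. 0) u)"
proof -
  have "compat (occ_seq (\<lambda>_. 0) u)" if "(s, u) \<in> (sym_cl (gct_rewrite \<Theta>))\<^sup>+"
    using that
  proof induction
    case (base v)
    then show ?case
      using compat_start compat_rewrite occ_rewrite_occ_seq unfolding sym_cl_def by blast
  next
    case (step v w)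
    then show ?case
      using compat_rewrite occ_rewrite_occ_seq unfolding sym_cl_def by blast
  qed
  with assms compat_start show ?thesis
    by (auto simp: gct_class_def gct_cong_def star_on_def)
qed

lemma compat_step:
  assumes "compat T" "X \<in> set T"
  shows "lab ` X \<in> steps \<Theta>"
proof -
  have "X \<subseteq> \<Omega>" "X \<noteq> {}" using compat_Union[OF assms(1)] compat_nonempty[OF assms(1)] assms(2) by auto
  then show ?thesis
    using occs_events compat_sim[OF assms] by (auto simp: steps_def)
qed

lemma compat_step_seq: "compat T \<Longrightarrow> map (image lab) T \<in> step_seqs \<Theta>"
  using compat_step by (auto simp: step_seqs_def)

text \<open>By irreflexivity, a pair with equal labels is in neither \<open>ser\<close> nor
  \<open>inl\<close>. Agreement therefore orders the occurrences of one event as in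
  \<open>s\<close>, which is by number.\<close>

lemma occ_seq_compat:
  assumes "compat T"
  shows "occ_seq (\<lambda>_. 0) (map (image lab) T) = T"
proof (rule occ_seq_image)
  show "disj_blocks T" using assms by (rule compat_disj)
  fix e j assume "(e, j) \<in> \<Union> (set T)"
  then have j: "(e, j) \<in> \<Union> (set T\<^sub>0)" using compat_Union[OF assms] by (simp add: occs_occ_seq)
  then show "0 < j" by (rule occ_seq_gt)
  fix k :: nat assume k: "0 < k" "k < j"
  then have "((e, k), (e, j)) \<in> before s"
    using occ_seq_label_order[OF j] by (simp add: before_bef)
  with before_occs show "((e, k), (e, j)) \<in> bef T"
    using compat_agree[OF assms, of "(e, k)" "(e, j)"] ser_irrefl inl_irrefl by auto
qed

text \<open>Compatibility turns the blocks into steps. For a split, the joined step comes from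
  \<open>T\<close> and its two parts from \<open>U\<close>.\<close>

lemma gct_rewrite_image:
  assumes "occ_rewrite \<Theta> T U" "compat T"
  shows "(map (image lab) T, map (image lab) U) \<in> gct_rewrite \<Theta>"
proof -
  have U: "compat U" using assms compat_rewrite by blast
  from assms(1) show ?thesis
  proof cases
    case (split X Y W Z)
    have "lab ` X \<times> lab ` Y \<subseteq> ser \<Theta>" using split by auto
    moreover have "map (image lab) W \<in> step_seqs \<Theta>" "map (image lab) Z \<in> step_seqs \<Theta>"
      "lab ` X \<in> steps \<Theta>" "lab ` Y \<in> steps \<Theta>" "lab ` X \<union> lab ` Y \<in> steps \<Theta>"
      using compat_step_seq[OF U] compat_step_seq[OF assms(2)] split
      by (auto simp: step_seqs_def image_Un)
    ultimately show ?thesis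
      unfolding gct_rewrite_def split by (simp add: image_Un) blast
  next
    case (swap X Y W Z)
    have "lab ` X \<times> lab ` Y \<subseteq> inl \<Theta>" using swap by auto
    moreover have "map (image lab) W \<in> step_seqs \<Theta>" "map (image lab) Z \<in> step_seqs \<Theta>"
      "lab ` X \<in> steps \<Theta>" "lab ` Y \<in> steps \<Theta>"
      using compat_step_seq[OF U] swap by (auto simp: step_seqs_def)
    ultimately show ?thesis
      unfolding gct_rewrite_def swap by simp blast
  qed
qed

lemma equivclp_compat:
  assumes "equivclp (occ_rewrite \<Theta>) T U" "compat T"
  shows "compat U \<and> (map (image lab) T, map (image lab) U) \<in> gct_cong \<Theta>"
  using assms
proof (induction rule: equivclp_induct)
  case base
  then show ?case using compat_step_seq[of T] by (auto simp: gct_cong_def star_on_def)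
next
  case (step V W)
  then have V: "compat V" "(map (image lab) T, map (image lab) V) \<in> gct_cong \<Theta>" by auto
  have W: "compat W" using step.hyps(2) V(1) compat_rewrite by blast
  have "(map (image lab) V, map (image lab) W) \<in> sym_cl (gct_rewrite \<Theta>)"
    using step.hyps(2) gct_rewrite_image V(1) W by (auto simp: sym_cl_def)
  with V(2) W show ?case
    by (auto simp: gct_cong_def star_on_def intro: trancl_into_trancl)
qed

section \<open>Connecting compatible partitions\<close>

definition connected where
  "connected T \<longleftrightarrow> (\<forall>X\<in>set T. X \<times> X \<subseteq> sqs)"

text \<open>Induction on the number of pairs left unordered. A block that is not connected can be
  split along reachability from one of its elements, the unreached part going first; this orders at
  least one new pair.\<close>

lemma refine_to_connected:
  assumes "compat T"
  shows "\<exists>U. equivclp (occ_rewrite \<Theta>) T U \<and> compat U \<and> connected U"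
  using assms
proof (induction "card (\<Omega> \<times> \<Omega> - bef T)" arbitrary: T rule: less_induct)
  case less
  note c = less.prems
  show ?case
  proof (cases "connected T")
    case True
    with c show ?thesis using equivclp_refl[of "occ_rewrite \<Theta>" T] by iprover
  next
    case False
    then obtain X x y where X: "X \<in> set T" and xy: "x \<in> X" "y \<in> X" "(x, y) \<notin> sqs"
      unfolding connected_def by blast
    have "X \<subseteq> \<Omega>" using X compat_Union[OF c] by auto
    \<comment> \<open>No \<open>\<sqsubset>\<^sub>s\<close> edge leaves the part \<open>B\<close> reachable from \<open>x\<close>, hence \<open>C \<times> B\<close> lies in \<open>ser\<close>.\<close>
    define B where "B = {z \<in> X. (x, z) \<in> sqs}"
    define C where "C = X - B"
    have x: "x \<in> B" and y: "y \<in> C"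
      using xy \<open>X \<subseteq> \<Omega>\<close> by (auto simp: B_def C_def sqs_refl)
    have ser: "(lab c, lab b) \<in> ser \<Theta>" if "c \<in> C" "b \<in> B" for c b
    proof (rule ccontr)
      assume "(lab c, lab b) \<notin> ser \<Theta>"
      have cb: "c \<in> X" "b \<in> X" "c \<noteq> b" using that by (auto simp: B_def C_def)
      then have "(lab c, lab b) \<notin> inl \<Theta>"
        using compat_sim[OF c X] sim_not_inl by blast
      moreover have "(c, b) \<notin> bef T"
        using block_unordered[OF compat_disj[OF c] X] cb by blast
      ultimately have "(b, c) \<in> sqsub_rel \<Theta> s"
        using cb \<open>X \<subseteq> \<Omega>\<close> \<open>(lab c, lab b) \<notin> ser \<Theta>\<close> compat_agree[OF c, of c b]
        by (auto simp: sqsub_rel_iff)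
      then have "(x, c) \<in> sqs" using that(2) by (auto simp: B_def intro: sqs_step)
      with that(1) cb show False by (auto simp: B_def C_def)
    qed
    obtain W Z where T: "T = W @ [X] @ Z" using X by (auto dest: split_list)
    let ?U = "W @ [C, B] @ Z"
    have "C \<union> B = X" by (auto simp: B_def C_def)
    then have rew: "occ_rewrite \<Theta> T ?U"
      using occ_rewrite.split[of C B \<Theta> W Z] ser x y unfolding T by auto
    then have U: "compat ?U" using c compat_rewrite by blast
    have "finite (\<Omega> \<times> \<Omega>)"
      using finite_occs[of \<Theta> s] s alphabet by (auto simp: gcomtrace_alphabet_def)
    moreover have "(y, x) \<in> \<Omega> \<times> \<Omega> - bef T"
      using block_unordered[OF compat_disj[OF c] X] xy \<open>X \<subseteq> \<Omega>\<close> by blast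
    moreover have "bef T \<subseteq> bef ?U" "(y, x) \<in> bef ?U"
      using x y \<open>C \<union> B = X\<close> unfolding T by (auto simp: bef_append)
    ultimately have "card (\<Omega> \<times> \<Omega> - bef ?U) < card (\<Omega> \<times> \<Omega> - bef T)"
      by (intro psubset_card_mono) auto
    from less.hyps[OF this U] rew show ?thesis
      by (meson equivclp_trans r_into_equivclp)
  qed
qed

text \<open>Mutually reachable occurrences share a block in every compatible partition, and
  connectedness gives the converse. Hence the set of blocks depends on \<open>s\<close> alone, and
  two such partitions differ only in the order of their blocks.\<close>

lemma connected_blocks:
  assumes c: "compat T" and "connected T"
  shows "set T = (\<lambda>\<alpha>. {\<beta>. (\<alpha>, \<beta>) \<in> sqs \<and> (\<beta>, \<alpha>) \<in> sqs}) ` \<Omega>"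
proof -
  have eq: "X = {\<beta>. (\<alpha>, \<beta>) \<in> sqs \<and> (\<beta>, \<alpha>) \<in> sqs}" if X: "X \<in> set T" and \<alpha>: "\<alpha> \<in> X" for X \<alpha>
  proof (rule set_eqI)
    fix \<beta>
    have "\<beta> \<in> X" if "(\<alpha>, \<beta>) \<in> sqs" "(\<beta>, \<alpha>) \<in> sqs"
      using compat_same_block[OF c, of \<alpha> \<beta>] compat_sqs[OF c that(1)] compat_sqs[OF c that(2)]
        block_unique[OF compat_disj[OF c] X _ \<alpha>] by auto
    then show "\<beta> \<in> X \<longleftrightarrow> \<beta> \<in> {\<beta>. (\<alpha>, \<beta>) \<in> sqs \<and> (\<beta>, \<alpha>) \<in> sqs}"
      using assms(2) X \<alpha> by (auto simp: connected_def)
  qed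
  show ?thesis
  proof (intro equalityI subsetI)
    fix X assume X: "X \<in> set T"
    then obtain \<alpha> where \<alpha>: "\<alpha> \<in> X" using compat_nonempty[OF c] by (cases "X = {}") auto
    then have "\<alpha> \<in> \<Omega>" using X compat_Union[OF c] by auto
    with eq[OF X \<alpha>] show "X \<in> (\<lambda>\<alpha>. {\<beta>. (\<alpha>, \<beta>) \<in> sqs \<and> (\<beta>, \<alpha>) \<in> sqs}) ` \<Omega>" by blast
  next
    fix X assume "X \<in> (\<lambda>\<alpha>. {\<beta>. (\<alpha>, \<beta>) \<in> sqs \<and> (\<beta>, \<alpha>) \<in> sqs}) ` \<Omega>"
    then obtain \<alpha> where "\<alpha> \<in> \<Omega>" and X: "X = {\<beta>. (\<alpha>, \<beta>) \<in> sqs \<and> (\<beta>, \<alpha>) \<in> sqs}" by blast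
    then obtain Y where "Y \<in> set T" "\<alpha> \<in> Y" using compat_Union[OF c] by blast
    with eq[of Y \<alpha>] X show "X \<in> set T" by simp
  qed
qed

lemma swap_adjacent:
  assumes T: "compat (W @ [X, Y] @ Z)" and U: "compat U" and YX: "Y \<times> X \<subseteq> bef U"
    and conn: "X \<times> X \<subseteq> sqs" "Y \<times> Y \<subseteq> sqs"
  shows "equivclp (occ_rewrite \<Theta>) (W @ [X, Y] @ Z) (W @ [Y, X] @ Z)"
proof -
  let ?T = "W @ [X, Y] @ Z"
  have ne: "X \<noteq> {}" "Y \<noteq> {}" using compat_nonempty[OF T] by auto
  have sub: "X \<subseteq> \<Omega>" "Y \<subseteq> \<Omega>" using compat_Union[OF T] by auto
  have XY: "(\<alpha>, \<beta>) \<in> bef ?T" "(\<beta>, \<alpha>) \<notin> bef ?T" "(\<alpha>, \<beta>) \<notin> bef U" "(\<beta>, \<alpha>) \<in> bef U"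
    if "\<alpha> \<in> X" "\<beta> \<in> Y" for \<alpha> \<beta>
  proof -
    show "(\<alpha>, \<beta>) \<in> bef ?T" using that by (auto simp: bef_append)
    then show "(\<beta>, \<alpha>) \<notin> bef ?T" by (rule bef_asym[OF compat_disj[OF T]])
    show "(\<beta>, \<alpha>) \<in> bef U" using that YX by auto
    then show "(\<alpha>, \<beta>) \<notin> bef U" by (rule bef_asym[OF compat_disj[OF U]])
  qed
  \<comment> \<open>The two partitions order the pair oppositely, yet both agree with
    \<open>s\<close> on label pairs outside \<open>ser\<close> and \<open>inl\<close>.\<close>
  have indep: "(lab \<alpha>, lab \<beta>) \<in> ser \<Theta> \<union> inl \<Theta> \<and> (lab \<beta>, lab \<alpha>) \<in> ser \<Theta> \<union> inl \<Theta>"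
    if "\<alpha> \<in> X" "\<beta> \<in> Y" for \<alpha> \<beta>
    using XY[OF that] that sub compat_agree[OF T, of \<alpha> \<beta>] compat_agree[OF U, of \<alpha> \<beta>]
      compat_agree[OF T, of \<beta> \<alpha>] compat_agree[OF U, of \<beta> \<alpha>] by blast
  show ?thesis
  proof (cases "\<exists>\<alpha>\<in>X. \<exists>\<beta>\<in>Y. (lab \<alpha>, lab \<beta>) \<in> inl \<Theta>")
    case True
    then obtain \<alpha> \<beta> where ab: "\<alpha> \<in> X" "\<beta> \<in> Y" and inl: "(lab \<alpha>, lab \<beta>) \<in> inl \<Theta>" by blast
    have "(lab \<gamma>, lab \<delta>) \<in> inl \<Theta>" if cd: "\<gamma> \<in> X" "\<delta> \<in> Y" for \<gamma> \<delta>
    proof (rule ccontr)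
      assume not_inl: "(lab \<gamma>, lab \<delta>) \<notin> inl \<Theta>"
      have sync: "(\<alpha>, \<gamma>) \<in> sqs" "(\<gamma>, \<alpha>) \<in> sqs" "(\<delta>, \<beta>) \<in> sqs" "(\<beta>, \<delta>) \<in> sqs"
        using conn ab cd by auto
      have "\<alpha> \<in> \<Omega>" "\<beta> \<in> \<Omega>" "\<gamma> \<in> \<Omega>" "\<delta> \<in> \<Omega>" using ab cd sub by auto
      \<comment> \<open>An \<open>inl\<close> pair is ordered in \<open>s\<close> as well. Since
        \<gamma> and \<delta> make it forced in that direction, both partitions would have to follow
        it, but one of them has the opposite order.\<close>
      then consider "(\<alpha>, \<beta>) \<in> before s" | "(\<beta>, \<alpha>) \<in> before s"
        using compat_inl_ordered[OF compat_start _ _ inl] by (auto simp: before_bef)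
      then show False
      proof cases
        case 1
        then have "(\<alpha>, \<beta>) \<in> forced"
          using inl not_inl sync \<open>\<gamma> \<in> \<Omega>\<close> \<open>\<delta> \<in> \<Omega>\<close> unfolding forced_def by blast
        with XY(3)[OF ab] compat_forced[OF U] show False by blast
      next
        case 2
        moreover have "(lab \<beta>, lab \<alpha>) \<in> inl \<Theta>" "(lab \<delta>, lab \<gamma>) \<notin> inl \<Theta>"
          using inl not_inl inl_sym by blast+
        ultimately have "(\<beta>, \<alpha>) \<in> forced"
          using sync \<open>\<gamma> \<in> \<Omega>\<close> \<open>\<delta> \<in> \<Omega>\<close> unfolding forced_def by blast
        with XY(2)[OF ab] compat_forced[OF T] show False by blast
      qed
    qed
    then show ?thesis using ne by (intro r_into_equivclp occ_rewrite.swap) auto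
  next
    case False
    then have "\<forall>\<alpha>\<in>X. \<forall>\<beta>\<in>Y. (lab \<alpha>, lab \<beta>) \<in> ser \<Theta>" "\<forall>\<beta>\<in>Y. \<forall>\<alpha>\<in>X. (lab \<beta>, lab \<alpha>) \<in> ser \<Theta>"
      using indep inl_sym by blast+
    then have "occ_rewrite \<Theta> (W @ [X \<union> Y] @ Z) ?T" "occ_rewrite \<Theta> (W @ [X \<union> Y] @ Z) (W @ [Y, X] @ Z)"
      using occ_rewrite.split[of X Y \<Theta> W Z] occ_rewrite.split[of Y X \<Theta> W Z] ne
      by (simp_all add: Un_commute)
    then show ?thesis by (meson equivclp_trans r_into_equivclp converse_r_into_equivclp)
  qed
qed

lemma move_to_front:
  assumes "compat (P @ W @ [X] @ Z)" "compat U" "\<And>B. B \<in> set W \<Longrightarrow> X \<times> B \<subseteq> bef U"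
    and "X \<times> X \<subseteq> sqs" "\<And>B. B \<in> set W \<Longrightarrow> B \<times> B \<subseteq> sqs"
  shows "equivclp (occ_rewrite \<Theta>) (P @ W @ [X] @ Z) (P @ [X] @ W @ Z)"
  using assms(1,3,5)
proof (induction W arbitrary: Z rule: rev_induct)
  case (snoc B W)
  have sw: "equivclp (occ_rewrite \<Theta>) ((P @ W) @ [B, X] @ Z) ((P @ W) @ [X, B] @ Z)"
    using snoc.prems assms(2,4) by (intro swap_adjacent[OF _ assms(2)]) auto
  moreover have "compat ((P @ W) @ [X, B] @ Z)"
    using equivclp_compat[OF sw] snoc.prems(1) by simp
  then have "equivclp (occ_rewrite \<Theta>) (P @ W @ [X] @ (B # Z)) (P @ [X] @ W @ (B # Z))"
    using snoc.prems by (intro snoc.IH) auto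
  ultimately show ?case using equivclp_trans by force
qed simp

lemma connected_same_blocks_equiv:
  assumes "compat (P @ T)" "compat (P @ U)" "set T = set U" "connected U"
  shows "equivclp (occ_rewrite \<Theta>) (P @ T) (P @ U)"
  using assms
proof (induction U arbitrary: P T)
  case (Cons X U)
  obtain W Z where T: "T = W @ X # Z" using Cons.prems(3) by (metis list.set_intros(1) split_list)
  have "distinct T" "distinct (X # U)"
    using disj_distinct[OF compat_disj compat_nonempty] Cons.prems(1,2) by (metis distinct_append)+
  then have sets: "set (W @ Z) = set U" using Cons.prems(3) unfolding T by auto
  have mv: "equivclp (occ_rewrite \<Theta>) (P @ W @ [X] @ Z) (P @ [X] @ W @ Z)"
    using Cons.prems(1,2,4) sets unfolding T
    by (intro move_to_front[where U = "P @ X # U"]) (auto simp: bef_append connected_def)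
  have "compat ((P @ [X]) @ W @ Z)"
    using equivclp_compat[OF mv] Cons.prems(1) by (simp add: T)
  then have "equivclp (occ_rewrite \<Theta>) ((P @ [X]) @ W @ Z) ((P @ [X]) @ U)"
    using Cons.prems sets by (intro Cons.IH) (auto simp: connected_def)
  with mv show ?case unfolding T by (simp, metis equivclp_trans)
qed simp

lemma compat_equiv:
  assumes "compat T" "compat U"
  shows "equivclp (occ_rewrite \<Theta>) T U"
proof -
  obtain T' where T': "equivclp (occ_rewrite \<Theta>) T T'" "compat T'" "connected T'"
    using refine_to_connected[OF assms(1)] by blast
  obtain U' where U': "equivclp (occ_rewrite \<Theta>) U U'" "compat U'" "connected U'"
    using refine_to_connected[OF assms(2)] by blast
  have "equivclp (occ_rewrite \<Theta>) T' U'"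
    using connected_same_blocks_equiv[of "[]" T' U'] T' U' connected_blocks by simp
  with T'(1) U'(1) show ?thesis by (meson equivclp_sym equivclp_trans)
qed

section \<open>Extensions of the structure\<close>

lemma prec_rel_iff:
  "(\<alpha>, \<beta>) \<in> prec_rel \<Theta> s \<longleftrightarrow> (\<alpha>, \<beta>) \<in> before s \<and>
     ((lab \<alpha>, lab \<beta>) \<notin> ser \<Theta> \<union> inl \<Theta> \<or> (\<alpha>, \<beta>) \<in> forced \<or>
      (lab \<alpha>, lab \<beta>) \<in> ser \<Theta> \<and>
      (\<exists>\<delta>\<in>\<Omega>. \<exists>\<gamma>\<in>\<Omega>. (\<delta>, \<gamma>) \<in> before s \<and> (lab \<delta>, lab \<gamma>) \<notin> ser \<Theta> \<and>
         (\<alpha>, \<delta>) \<in> sqs \<and> (\<delta>, \<beta>) \<in> sqs \<and> (\<alpha>, \<gamma>) \<in> sqs \<and> (\<gamma>, \<beta>) \<in> sqs))"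
proof -
  have "(\<alpha>, \<beta>) \<in> com_rel \<Theta> s \<inter> (sym_core sqs O compl_on \<Omega> (com_rel \<Theta> s) O sym_core sqs) \<longleftrightarrow>
      (\<alpha>, \<beta>) \<in> forced" if "(\<alpha>, \<beta>) \<in> before s"
    using that before_occs
    unfolding forced_def com_rel_def sym_core_def compl_on_def by blast
  then show ?thesis
    unfolding prec_rel_def Let_def sqs_def[symmetric] by blast
qed

lemma prec_rel_occs: "(\<alpha>, \<beta>) \<in> prec_rel \<Theta> s \<Longrightarrow> \<alpha> \<in> \<Omega> \<and> \<beta> \<in> \<Omega> \<and> \<alpha> \<noteq> \<beta>"
  by (auto simp: prec_rel_def before_def Let_def)

lemma extensions_iff:
  "lt \<in> extensions (gct_structure \<Theta> s) \<longleftrightarrow>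
     stratified_order \<Omega> lt \<and>
     (\<forall>\<alpha> \<beta>. (\<alpha>, \<beta>) \<in> com_rel \<Theta> s \<longrightarrow> (\<alpha>, \<beta>) \<in> lt \<or> (\<beta>, \<alpha>) \<in> lt) \<and>
     prec_rel \<Theta> s \<subseteq> lt \<and>
     (\<forall>\<alpha> \<beta>. (\<alpha>, \<beta>) \<in> sqsub_rel \<Theta> s \<longrightarrow> (\<beta>, \<alpha>) \<notin> lt)"
    (is "_ \<longleftrightarrow> ?rhs")
proof -
  define R1 where "R1 = prec_rel \<Theta> s \<union> com_rel \<Theta> s"
  define R2 where "R2 = prec_rel \<Theta> s \<union> sqsub_rel \<Theta> s"
  define R3 where "R3 = R1 \<inter> star_on \<Omega> R2"
  have G: "gct_structure \<Theta> s = (\<Omega>, sym_cl (prec_cl \<Omega> R3 R2) \<union> R1, sqsub_cl \<Omega> R3 R2)"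
    by (simp add: gct_structure_def Let_def R1_def R2_def R3_def)
  show ?thesis
  proof
    assume "lt \<in> extensions (gct_structure \<Theta> s)"
    then have lt: "stratified_order \<Omega> lt"
      and com: "(\<alpha>, \<beta>) \<in> R1 \<Longrightarrow> (\<alpha>, \<beta>) \<in> lt \<or> (\<beta>, \<alpha>) \<in> lt"
      and sq: "(\<alpha>, \<beta>) \<in> sqsub_cl \<Omega> R3 R2 \<Longrightarrow> (\<beta>, \<alpha>) \<notin> lt" for \<alpha> \<beta>
      unfolding G extensions.simps by blast+
    have sq2: "(\<beta>, \<alpha>) \<notin> lt" if "(\<alpha>, \<beta>) \<in> R2" for \<alpha> \<beta>
    proof -
      have "\<alpha> \<noteq> \<beta>" using that prec_rel_occs[of \<alpha> \<beta>] by (auto simp: R2_def sqsub_rel_iff)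
      with that show ?thesis by (intro sq) (auto simp: sqsub_cl_def star_on_def)
    qed
    have "prec_rel \<Theta> s \<subseteq> lt"
      using com sq2 unfolding R1_def R2_def by (intro subrelI) blast
    then show ?rhs using lt com sq2 unfolding R1_def R2_def by blast
  next
    assume rhs: ?rhs
    then have lt: "stratified_order \<Omega> lt" and prec: "prec_rel \<Theta> s \<subseteq> lt"
      and com: "(\<alpha>, \<beta>) \<in> com_rel \<Theta> s \<Longrightarrow> (\<alpha>, \<beta>) \<in> lt \<or> (\<beta>, \<alpha>) \<in> lt"
      and sq: "(\<alpha>, \<beta>) \<in> sqsub_rel \<Theta> s \<Longrightarrow> (\<beta>, \<alpha>) \<notin> lt" for \<alpha> \<beta>
      by blast+
    have asym: "(\<beta>, \<alpha>) \<notin> lt" if "(\<alpha>, \<beta>) \<in> lt" for \<alpha> \<beta>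
      using lt that unfolding stratified_order_def irrefl_def trans_def by blast
    have carrier: "\<alpha> \<in> \<Omega> \<and> \<beta> \<in> \<Omega>" if "(\<alpha>, \<beta>) \<in> lt" for \<alpha> \<beta>
      using lt that by (auto simp: stratified_order_def)
    have R2: "\<alpha> \<in> \<Omega> \<and> \<beta> \<in> \<Omega> \<and> (\<beta>, \<alpha>) \<notin> lt" if "(\<alpha>, \<beta>) \<in> R2" for \<alpha> \<beta>
      using that prec asym prec_rel_occs[of \<alpha> \<beta>] sq[of \<alpha> \<beta>] sqsub_rel_iff[of \<alpha> \<beta>]
      unfolding R2_def by blast
    have R3: "(\<alpha>, \<beta>) \<in> lt" if "(\<alpha>, \<beta>) \<in> R3" for \<alpha> \<beta>
      using that star_on_not_greater[OF lt, of \<alpha> \<beta> R2] R2 prec com[of \<alpha> \<beta>]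
      unfolding R3_def R1_def by blast
    have star: "\<alpha> \<in> \<Omega> \<and> \<beta> \<in> \<Omega> \<and> (\<beta>, \<alpha>) \<notin> lt" if "(\<alpha>, \<beta>) \<in> star_on \<Omega> (R3 \<union> R2)" for \<alpha> \<beta>
      using star_on_not_greater[OF lt that] R2 R3 asym carrier by blast
    have "prec_cl \<Omega> R3 R2 \<subseteq> lt"
    proof (clarsimp simp: prec_cl_def)
      fix a b c d assume "(a, b) \<in> star_on \<Omega> (R3 \<union> R2)" "(b, c) \<in> R3" "(c, d) \<in> star_on \<Omega> (R3 \<union> R2)"
      with star R3 stratified_order_weak[OF lt] show "(a, d) \<in> lt" by metis
    qed
    moreover have "\<alpha> \<noteq> \<beta> \<and> (\<beta>, \<alpha>) \<notin> lt" if "(\<alpha>, \<beta>) \<in> sqsub_cl \<Omega> R3 R2" for \<alpha> \<beta>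
      using that star[of \<alpha> \<beta>] unfolding sqsub_cl_def by blast
    ultimately show "lt \<in> extensions (gct_structure \<Theta> s)"
      using lt com prec unfolding G extensions.simps sym_cl_def R1_def by blast
  qed
qed

lemma compat_prec:
  assumes c: "compat T" and "(\<alpha>, \<beta>) \<in> prec_rel \<Theta> s"
  shows "(\<alpha>, \<beta>) \<in> bef T"
proof -
  have \<alpha>\<beta>: "(\<alpha>, \<beta>) \<in> before s" "\<alpha> \<in> \<Omega>" "\<beta> \<in> \<Omega>"
    using assms(2) prec_rel_occs[of \<alpha> \<beta>] unfolding prec_rel_iff by blast+
  from assms(2) consider "(lab \<alpha>, lab \<beta>) \<notin> ser \<Theta> \<union> inl \<Theta>" | "(\<alpha>, \<beta>) \<in> forced"
    | \<delta> \<gamma> where "(\<delta>, \<gamma>) \<in> before s" "(lab \<delta>, lab \<gamma>) \<notin> ser \<Theta>"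
        "(\<alpha>, \<delta>) \<in> sqs" "(\<delta>, \<beta>) \<in> sqs" "(\<alpha>, \<gamma>) \<in> sqs" "(\<gamma>, \<beta>) \<in> sqs"
    unfolding prec_rel_iff by blast
  then show ?thesis
  proof cases
    case 1
    with \<alpha>\<beta> compat_agree[OF c] show ?thesis by auto
  next
    case 2
    with compat_forced[OF c] show ?thesis .
  next
    case 3
    note sq = compat_sqs[OF c 3(3)] compat_sqs[OF c 3(4)] compat_sqs[OF c 3(5)] compat_sqs[OF c 3(6)]
    have "(\<delta>, \<gamma>) \<in> bef T \<or> (\<gamma>, \<delta>) \<in> bef T"
      using compat_inl_ordered[OF c, of \<delta> \<gamma>] compat_agree[OF c, of \<delta> \<gamma>] 3 sq by blast
    with sq show ?thesis
      using stratified_order_weak[OF compat_stratified[OF c]] by metis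
  qed
qed

lemma bef_extension:
  assumes c: "compat T"
  shows "bef T \<in> extensions (gct_structure \<Theta> s)"
  unfolding extensions_iff
  using compat_stratified[OF c] compat_inl_ordered[OF c] compat_prec[OF c] compat_agree[OF c]
  by (auto simp: com_rel_def sqsub_rel_iff)

lemma extension_bef:
  assumes "lt \<in> extensions (gct_structure \<Theta> s)"
  shows "\<exists>T. compat T \<and> bef T = lt"
proof -
  have lt: "stratified_order \<Omega> lt" and prec: "prec_rel \<Theta> s \<subseteq> lt"
    and com: "(\<alpha>, \<beta>) \<in> com_rel \<Theta> s \<Longrightarrow> (\<alpha>, \<beta>) \<in> lt \<or> (\<beta>, \<alpha>) \<in> lt"
    and sq: "(\<alpha>, \<beta>) \<in> sqsub_rel \<Theta> s \<Longrightarrow> (\<beta>, \<alpha>) \<notin> lt" for \<alpha> \<beta>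
    using assms unfolding extensions_iff by blast+
  have "finite \<Omega>" using finite_occs[of \<Theta> s] s alphabet by (auto simp: gcomtrace_alphabet_def)
  then obtain T where T: "\<Union> (set T) = \<Omega>" "{} \<notin> set T" "disj_blocks T" "bef T = lt"
    using ordered_partition_exists[of \<Omega> lt] lt stratified_order_weak[OF lt]
    by (auto simp: stratified_order_def)
  have agree: "(\<alpha>, \<beta>) \<in> lt \<longleftrightarrow> (\<alpha>, \<beta>) \<in> before s"
    if "\<alpha> \<in> \<Omega>" "\<beta> \<in> \<Omega>" "(lab \<alpha>, lab \<beta>) \<notin> ser \<Theta> \<union> inl \<Theta>" for \<alpha> \<beta>
  proof
    assume "(\<alpha>, \<beta>) \<in> before s"
    with that prec show "(\<alpha>, \<beta>) \<in> lt" by (auto simp: prec_rel_iff)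
  next
    assume lt': "(\<alpha>, \<beta>) \<in> lt"
    then have "\<alpha> \<noteq> \<beta>" using lt unfolding stratified_order_def irrefl_def by blast
    with lt' that sq[of \<beta> \<alpha>] show "(\<alpha>, \<beta>) \<in> before s" by (auto simp: sqsub_rel_iff)
  qed
  have "(lab \<alpha>, lab \<beta>) \<in> sim \<Theta>" if X: "X \<in> set T" "\<alpha> \<in> X" "\<beta> \<in> X" "\<alpha> \<noteq> \<beta>" for X \<alpha> \<beta>
  proof (rule ccontr)
    assume not_sim: "(lab \<alpha>, lab \<beta>) \<notin> sim \<Theta>"
    have in_occs: "\<alpha> \<in> \<Omega>" "\<beta> \<in> \<Omega>" using X T(1) by auto
    have un: "(\<alpha>, \<beta>) \<notin> lt" "(\<beta>, \<alpha>) \<notin> lt"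
      using block_unordered[OF T(3) X(1)] X T(4) by auto
    then have "(lab \<alpha>, lab \<beta>) \<notin> inl \<Theta>" "(lab \<beta>, lab \<alpha>) \<notin> inl \<Theta>"
      using com[of \<alpha> \<beta>] com[of \<beta> \<alpha>] in_occs by (auto simp: com_rel_def)
    moreover have "(lab \<alpha>, lab \<beta>) \<notin> ser \<Theta>" "(lab \<beta>, lab \<alpha>) \<notin> ser \<Theta>"
      using not_sim ser_sim sim_sym by blast+
    ultimately have "(\<alpha>, \<beta>) \<notin> before s" "(\<beta>, \<alpha>) \<notin> before s"
      using agree[of \<alpha> \<beta>] agree[of \<beta> \<alpha>] un in_occs by auto
    then obtain Y where "Y \<in> set T\<^sub>0" "\<alpha> \<in> Y" "\<beta> \<in> Y"
      using compat_same_block[OF compat_start in_occs] by (auto simp: before_bef)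
    with compat_sim[OF compat_start] X(4) not_sim show False by blast
  qed
  moreover have "forced \<subseteq> lt"
  proof (rule subrelI)
    fix \<alpha> \<beta> assume "(\<alpha>, \<beta>) \<in> forced"
    then have "(\<alpha>, \<beta>) \<in> prec_rel \<Theta> s" unfolding prec_rel_iff forced_def by blast
    with prec show "(\<alpha>, \<beta>) \<in> lt" by blast
  qed
  ultimately have "compat T" using T agree unfolding compat_def by blast
  with T(4) show ?thesis by blast
qed

theorem extensions_eq: "extensions (gct_structure \<Theta> s) = {before u | u. u \<in> gct_class \<Theta> s}"
proof (intro equalityI subsetI)
  fix lt assume "lt \<in> extensions (gct_structure \<Theta> s)"
  then obtain T where T: "compat T" "bef T = lt" using extension_bef by blast
  let ?u = "map (image lab) T"
  have "(map (image lab) T\<^sub>0, ?u) \<in> gct_cong \<Theta>"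
    using equivclp_compat[OF compat_equiv[OF compat_start T(1)] compat_start] by blast
  then have "?u \<in> gct_class \<Theta> s" by (simp add: gct_class_def image_occ_seq)
  moreover have "before ?u = lt" using T by (simp add: before_bef occ_seq_compat)
  ultimately show "lt \<in> {before u | u. u \<in> gct_class \<Theta> s}" by blast
next
  fix lt assume "lt \<in> {before u | u. u \<in> gct_class \<Theta> s}"
  then obtain u where "u \<in> gct_class \<Theta> s" "lt = before u" by blast
  then show "lt \<in> extensions (gct_structure \<Theta> s)"
    using bef_extension[OF compat_class] by (simp add: before_bef)
qed

end

theorem theorem11p4:
  fixes \<Theta> :: "'e gct_alphabet" and s :: "'e set list"
  assumes "gcomtrace_alphabet \<Theta>" and "s \<in> step_seqs \<Theta>"
  shows "extensions (gct_structure \<Theta> s) = {before u | u. u \<in> gct_class \<Theta> s}"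
proof -
  interpret gct_seq \<Theta> s using assms by unfold_locales
  show ?thesis by (rule extensions_eq)
qed

end
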